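(* Let $f_1,\dots,f_s$ be nonzero elements of $\mathbf F=\mathbb K[\![x_1,\dots,x_n]\!]$, let $\mathbf A=\mathbb K[\![f_1,\dots,f_s]\!]$ and let $a\in U^n$. For all $i\in\{1,\dots,s\}$, write $\mathrm M(f_i,a)=c_{\alpha_i}\underline x^{\alpha_i}$. Let $C=\{\sum_{i=1}^s\lambda_i\alpha_i\mid\lambda_i\in\mathbb R_+\}$ be the cone generated by $\{\alpha_1,\dots,\alpha_s\}$, and let $\mathbf F_C=\{f\in\mathbf F\mid\mathrm{Supp}(f)\subseteq C\}$. If $\mathrm M(\mathbf A,a)\subseteq\mathbf F_C$, then $\mathrm{exp}(\mathbf A,a)$ is finitely generated.
   Context: $\mathbb K$ is a field, $n\ge 1$, $\underline x=(x_1,\dots,x_n)$, $\mathbf F=\mathbb K[\![x_1,\dots,x_n]\!]$, $U=\mathbb R_{>0}$, $\mathbb R_+=[0,\infty)$. Fix a total well ordering $\prec$ on $\mathbb N^n$ compatible with sums. For $a\in U^n$ and a nonzero $f=\sum c_\alpha\underline x^\alpha\in\mathbf F$: $\mathrm{Supp}(f)=\{\alpha\mid c_\alpha\ne0\}$; $\nu(f,a)=\min\{a\cdot\alpha\mid\alpha\in\mathrm{Supp}(f)\}$; $\mathrm{in}(f,a)=\sum_{\alpha\in\mathrm{Supp}(f),\,a\cdot\alpha=\nu(f,a)}c_\alpha\underline x^\alpha$; $\mathrm{exp}(f,a)=\max_\prec\mathrm{Supp}(\mathrm{in}(f,a))$; $\mathrm M(f,a)=c_{\mathrm{exp}(f,a)}\underline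 x^{\mathrm{exp}(f,a)}$. For $S\subseteq\mathbf F$, $\mathbb K[\![S]\!]$ is the closure, in the $(x_1,\dots,x_n)$-adic topology, of the $\mathbb K$-subalgebra of $\mathbf F$ generated by $S$ (for a finite set of series without constant term it is the set of all formal power series in them). $\mathrm M(\mathbf A,a)=\mathbb K[\![\mathrm M(f,a), f\in\mathbf A\setminus\{0\}]\!]$ and $\mathrm{exp}(\mathbf A,a)=\{\mathrm{exp}(f,a)\mid f\in\mathbf A\setminus\{0\}\}$, a subsemigroup of $\mathbb N^n$ containing $0$. *)

theory Defs
  imports "HOL-Analysis.Analysis"
begin

section \<open>Formal power series in several variables\<close>

text \<open>
  The finite type \<open>'n\<close> indexes the variables and a multi-index is an element of \<open>nat^'n\<close>.
\<close>

typedef ('a, 'n) mfps = "UNIV :: (nat^'n \<Rightarrow> 'a) set"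
  morphisms mcoeff Abs_mfps ..

lemma mcoeff_Abs [simp]: "mcoeff (Abs_mfps c) = c"
  by (simp add: Abs_mfps_inverse)

lemma mfps_eq_iff: "f = g \<longleftrightarrow> (\<forall>\<alpha>. mcoeff f \<alpha> = mcoeff g \<alpha>)"
  by (metis ext mcoeff_inject)

lemma mfps_eqI: "(\<And>\<alpha>. mcoeff f \<alpha> = mcoeff g \<alpha>) \<Longrightarrow> f = g"
  by (simp add: mfps_eq_iff)

lemma finite_multi_index_le: "finite {\<beta> :: nat^'n::finite. \<forall>i. \<beta> $ i \<le> \<alpha> $ i}"
proof (rule finite_subset)
  show "{\<beta> :: nat^'n. \<forall>i. \<beta> $ i \<le> \<alpha> $ i} \<subseteq> vec_lambda ` (PiE UNIV (\<lambda>i. {..\<alpha> $ i}))"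
    by (auto intro!: image_eqI[where x = "vec_nth _"])
  show "finite (vec_lambda ` (PiE UNIV (\<lambda>i. {..\<alpha> $ i})))"
    by (intro finite_imageI finite_PiE) auto
qed

lemma finite_multi_index_split: "finite {(\<beta>, \<gamma>). \<beta> + \<gamma> = (\<alpha> :: nat^'n::finite)}"
  by (rule finite_subset[OF _ finite_cartesian_product[OF finite_multi_index_le[of \<alpha>] finite_multi_index_le[of \<alpha>]]])
     auto

instantiation mfps :: (comm_ring_1, finite) comm_ring_1
begin

definition zero_mfps_def: "0 = Abs_mfps (\<lambda>_. 0)"

definition one_mfps_def: "1 = Abs_mfps (\<lambda>\<alpha>. if \<alpha> = 0 then 1 else 0)"

definition plus_mfps_def: "f + g = Abs_mfps (\<lambda>\<alpha>. mcoeff f \<alpha> + mcoeff g \<alpha>)"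

definition uminus_mfps_def: "- f = Abs_mfps (\<lambda>\<alpha>. - mcoeff f \<alpha>)"

definition minus_mfps_def: "f - g = Abs_mfps (\<lambda>\<alpha>. mcoeff f \<alpha> - mcoeff g \<alpha>)"

definition times_mfps_def:
  "f * g = Abs_mfps (\<lambda>\<alpha>. \<Sum>(\<beta>, \<gamma>) \<in> {(\<beta>, \<gamma>). \<beta> + \<gamma> = \<alpha>}. mcoeff f \<beta> * mcoeff g \<gamma>)"

instance
proof
  fix f g h :: "('a, 'b) mfps"
  show "f * g * h = f * (g * h)"
  proof (rule mfps_eqI)
    fix \<alpha> :: "nat^'b"
    have "mcoeff (f * g * h) \<alpha> =
      (\<Sum>p \<in> {(\<beta>, \<gamma>). \<beta> + \<gamma> = \<alpha>}. \<Sum>q \<in> {(\<beta>, \<gamma>). \<beta> + \<gamma> = fst p}.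
         mcoeff f (fst q) * mcoeff g (snd q) * mcoeff h (snd p))"
      by (simp add: times_mfps_def sum_distrib_right case_prod_unfold)
    also have "\<dots> = (\<Sum>(p, q) \<in> (SIGMA p : {(\<beta>, \<gamma>). \<beta> + \<gamma> = \<alpha>}. {(\<beta>, \<gamma>). \<beta> + \<gamma> = fst p}).
         mcoeff f (fst q) * mcoeff g (snd q) * mcoeff h (snd p))"
      by (intro sum.Sigma ballI finite_multi_index_split)
    also have "\<dots> = (\<Sum>(p, q) \<in> (SIGMA p : {(\<beta>, \<gamma>). \<beta> + \<gamma> = \<alpha>}. {(\<beta>, \<gamma>). \<beta> + \<gamma> = snd p}).
         mcoeff f (fst p) * (mcoeff g (fst q) * mcoeff h (snd q)))"
      by (rule sum.reindex_bij_witness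
            [where i = "\<lambda>((u, v), (w, x)). ((u + w, x), (u, w))"
               and j = "\<lambda>((u, v), (w, x)). ((w, x + v), (x, v))"])
         (auto simp: add.assoc mult.assoc)
    also have "\<dots> = (\<Sum>p \<in> {(\<beta>, \<gamma>). \<beta> + \<gamma> = \<alpha>}. \<Sum>q \<in> {(\<beta>, \<gamma>). \<beta> + \<gamma> = snd p}.
         mcoeff f (fst p) * (mcoeff g (fst q) * mcoeff h (snd q)))"
      by (intro sum.Sigma[symmetric] ballI finite_multi_index_split)
    also have "\<dots> = mcoeff (f * (g * h)) \<alpha>"
      by (simp add: times_mfps_def sum_distrib_left case_prod_unfold)
    finally show "mcoeff (f * g * h) \<alpha> = mcoeff (f * (g * h)) \<alpha>" .
  qed
  show "f * g = g * f"
  proof (rule mfps_eqI)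
    fix \<alpha> :: "nat^'b"
    show "mcoeff (f * g) \<alpha> = mcoeff (g * f) \<alpha>"
      unfolding times_mfps_def mcoeff_Abs
      by (rule sum.reindex_bij_witness[where i = prod.swap and j = prod.swap])
         (auto simp: add.commute mult.commute)
  qed
  show "1 * f = f"
  proof (rule mfps_eqI)
    fix \<alpha> :: "nat^'b"
    have "mcoeff (1 * f) \<alpha> = (\<Sum>(\<beta>, \<gamma>) \<in> {(0, \<alpha>)}. mcoeff 1 \<beta> * mcoeff f \<gamma>)"
      unfolding times_mfps_def mcoeff_Abs
      by (rule sum.mono_neutral_right[OF finite_multi_index_split])
         (auto simp: one_mfps_def split: if_splits)
    then show "mcoeff (1 * f) \<alpha> = mcoeff f \<alpha>"
      by (simp add: one_mfps_def)
  qed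
  show "(f + g) * h = f * h + g * h"
    by (rule mfps_eqI)
       (simp add: times_mfps_def plus_mfps_def case_prod_unfold distrib_right sum.distrib)
  show "(0 :: ('a, 'b) mfps) \<noteq> 1"
    by (auto simp: mfps_eq_iff zero_mfps_def one_mfps_def)
qed (auto simp: mfps_eq_iff zero_mfps_def plus_mfps_def uminus_mfps_def minus_mfps_def add.assoc add.commute)

end

lemma mcoeff_zero [simp]: "mcoeff 0 \<alpha> = 0"
  by (simp add: zero_mfps_def)

lemma mcoeff_one: "mcoeff 1 \<alpha> = (if \<alpha> = 0 then 1 else 0)"
  by (simp add: one_mfps_def)

lemma mcoeff_add [simp]: "mcoeff (f + g) \<alpha> = mcoeff f \<alpha> + mcoeff g \<alpha>"
  by (simp add: plus_mfps_def)

lemma mcoeff_uminus [simp]: "mcoeff (- f) \<alpha> = - mcoeff f \<alpha>"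
  by (simp add: uminus_mfps_def)

lemma mcoeff_diff [simp]: "mcoeff (f - g) \<alpha> = mcoeff f \<alpha> - mcoeff g \<alpha>"
  by (simp add: minus_mfps_def)

lemma mcoeff_mult:
  "mcoeff (f * g) \<alpha> = (\<Sum>(\<beta>, \<gamma>) \<in> {(\<beta>, \<gamma>). \<beta> + \<gamma> = \<alpha>}. mcoeff f \<beta> * mcoeff g \<gamma>)"
  by (simp add: times_mfps_def)

lemma mcoeff_sum: "mcoeff (sum f A) \<alpha> = (\<Sum>x\<in>A. mcoeff (f x) \<alpha>)"
  by (induction A rule: infinite_finite_induct) auto

definition mfps_monom :: "'a \<Rightarrow> nat^'n \<Rightarrow> ('a :: comm_ring_1, 'n :: finite) mfps" where
  "mfps_monom c \<alpha> = Abs_mfps (\<lambda>\<beta>. if \<beta> = \<alpha> then c else 0)"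

lemma mcoeff_monom: "mcoeff (mfps_monom c \<alpha>) \<beta> = (if \<beta> = \<alpha> then c else 0)"
  by (simp add: mfps_monom_def)

definition mfps_var :: "'n \<Rightarrow> ('a :: comm_ring_1, 'n :: finite) mfps" where
  "mfps_var i = mfps_monom 1 (axis i 1)"

definition Supp :: "('a :: comm_ring_1, 'n :: finite) mfps \<Rightarrow> (nat^'n) set" where
  "Supp f = {\<alpha>. mcoeff f \<alpha> \<noteq> 0}"

section \<open>The adic topology\<close>

global_interpretation ideal: module "(*) :: 'r :: comm_ring_1 \<Rightarrow> 'r \<Rightarrow> 'r"
  by unfold_locales (simp_all add: algebra_simps)

text \<open>
  Submodules of a commutative ring over itself are its ideals, so \<open>ideal.span S\<close> is the ideal
  generated by \<open>S\<close>.
\<close>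

definition max_ideal :: "('a :: comm_ring_1, 'n :: finite) mfps set" where
  "max_ideal = ideal.span (range mfps_var)"

definition ideal_power :: "'r :: comm_ring_1 set \<Rightarrow> nat \<Rightarrow> 'r set" where
  "ideal_power I k = ideal.span {\<Prod>j<k. g j | g. \<forall>j<k. g j \<in> I}"

lemma ideal_power_Suc_subset: "ideal_power I (Suc k) \<subseteq> ideal_power I k"
  unfolding ideal_power_def
proof (rule ideal.span_minimal)
  show "{\<Prod>j<Suc k. g j | g. \<forall>j<Suc k. g j \<in> I} \<subseteq> ideal.span {\<Prod>j<k. g j | g. \<forall>j<k. g j \<in> I}"
  proof clarify
    fix g :: "nat \<Rightarrow> 'a"
    assume "\<forall>j<Suc k. g j \<in> I"
    then have "g k * (\<Prod>j<k. g j) \<in> ideal.span {\<Prod>j<k. g j | g. \<forall>j<k. g j \<in> I}"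
      by (intro ideal.span_scale ideal.span_base) auto
    then show "(\<Prod>j<Suc k. g j) \<in> ideal.span {\<Prod>j<k. g j | g. \<forall>j<k. g j \<in> I}"
      by (simp add: mult.commute)
  qed
qed (rule ideal.subspace_span)

lemma ideal_power_antimono: "k \<le> l \<Longrightarrow> ideal_power I l \<subseteq> ideal_power I k"
  by (rule lift_Suc_antimono_le[of "ideal_power I"]) (auto intro: subsetD[OF ideal_power_Suc_subset])

instantiation mfps :: (comm_ring_1, finite) topological_space
begin

definition open_mfps_def:
  "open U \<longleftrightarrow> (\<forall>f\<in>U. \<exists>k. \<forall>g. g - f \<in> ideal_power max_ideal k \<longrightarrow> g \<in> U)"
  for U :: "('a, 'b) mfps set"

instance
proof
  show "open (UNIV :: ('a, 'b) mfps set)"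
    by (simp add: open_mfps_def)
  show "open (S \<inter> T)" if S: "open S" and T: "open T" for S T :: "('a, 'b) mfps set"
    unfolding open_mfps_def
  proof
    fix f assume "f \<in> S \<inter> T"
    with S T obtain k l where
      k: "\<And>g. g - f \<in> ideal_power max_ideal k \<Longrightarrow> g \<in> S" and
      l: "\<And>g. g - f \<in> ideal_power max_ideal l \<Longrightarrow> g \<in> T"
      unfolding open_mfps_def by blast
    have "g \<in> S \<inter> T" if "g - f \<in> ideal_power max_ideal (max k l)" for g
      using that k[of g] l[of g] ideal_power_antimono[of k "max k l" max_ideal]
        ideal_power_antimono[of l "max k l" max_ideal] by auto
    then show "\<exists>k. \<forall>g. g - f \<in> ideal_power max_ideal k \<longrightarrow> g \<in> S \<inter> T"
      by blast
  qed
  show "open (\<Union>K)" if "\<forall>S\<in>K. open S" for K :: "('a, 'b) mfps set set"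
    using that unfolding open_mfps_def by (meson Union_iff)
qed

end

text \<open>The powers of the maximal ideal are described by the usual order of a series.\<close>

lemma mcoeff_monom_mult:
  "mcoeff (mfps_monom 1 \<alpha> * h) \<beta> = (if \<alpha> \<le> \<beta> then mcoeff h (\<beta> - \<alpha>) else 0)"
proof -
  have *: "\<alpha> + (\<beta> - \<alpha>) = \<beta>" if "\<alpha> \<le> \<beta>"
    using that by (auto simp: vec_eq_iff less_eq_vec_def)
  have "mcoeff (mfps_monom 1 \<alpha> * h) \<beta> =
    (\<Sum>(\<gamma>, \<delta>) \<in> (if \<alpha> \<le> \<beta> then {(\<alpha>, \<beta> - \<alpha>)} else {}). mcoeff (mfps_monom 1 \<alpha>) \<gamma> * mcoeff h \<delta>)"
    unfolding mcoeff_mult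
    by (rule sum.mono_neutral_right[OF finite_multi_index_split])
       (auto simp: mcoeff_monom * less_eq_vec_def split: if_splits)
  then show ?thesis
    by (simp add: mcoeff_monom)
qed

lemma monom_mult_monom: "mfps_monom 1 \<alpha> * mfps_monom 1 \<beta> = mfps_monom 1 (\<alpha> + \<beta>)"
  by (rule mfps_eqI)
     (auto simp: mcoeff_monom_mult mcoeff_monom less_eq_vec_def vec_eq_iff; metis le_add_diff_inverse)

lemma monom_in_ideal_power:
  fixes \<alpha> :: "nat^'n::finite"
  assumes "(\<Sum>i\<in>UNIV. \<alpha> $ i) = k"
  shows "mfps_monom 1 \<alpha> \<in> {\<Prod>j<k. g j | g. \<forall>j<k. g j \<in> (max_ideal :: ('a :: comm_ring_1, 'n) mfps set)}"
  using assms
proof (induction k arbitrary: \<alpha>)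
  case 0
  then have "\<alpha> = 0"
    by (simp add: vec_eq_iff)
  then show ?case
    by (auto simp: mfps_eq_iff mcoeff_one mcoeff_monom)
next
  case (Suc k)
  then obtain i where i: "\<alpha> $ i > 0"
    by (metis gr0I nat.distinct(1) sum.neutral)
  define \<beta> where "\<beta> = \<alpha> - axis i 1"
  have \<alpha>: "\<alpha> = \<beta> + axis i 1"
    using i by (auto simp: \<beta>_def vec_eq_iff axis_def)
  have "(\<Sum>j\<in>UNIV. \<beta> $ j) + (\<Sum>j\<in>UNIV. axis i (1::nat) $ j) = Suc k"
    using Suc.prems by (simp add: \<alpha> sum.distrib)
  moreover have "(\<Sum>j\<in>UNIV. axis i (1::nat) $ j) = 1"
    by (simp add: axis_def)
  ultimately have "(\<Sum>j\<in>UNIV. \<beta> $ j) = k"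
    by simp
  from Suc.IH[OF this] obtain g where
    g: "mfps_monom 1 \<beta> = (\<Prod>j<k. g j)" "\<forall>j<k. g j \<in> (max_ideal :: ('a, 'n) mfps set)"
    by blast
  have V: "mfps_var i \<in> (max_ideal :: ('a, 'n) mfps set)"
    unfolding max_ideal_def by (intro ideal.span_base) auto
  have "mfps_monom 1 \<alpha> = (\<Prod>j<Suc k. (g(k := mfps_var i)) j)"
    by (simp add: \<alpha> g(1)[symmetric] monom_mult_monom[symmetric] mfps_var_def)
  then show ?case
    using g(2) V by (auto intro!: exI[of _ "g(k := mfps_var i)"])
qed

lemma ex_multi_index_le:
  fixes \<beta> :: "nat^'n::finite"
  assumes "k \<le> (\<Sum>i\<in>UNIV. \<beta> $ i)"
  shows "\<exists>\<alpha>. \<alpha> \<le> \<beta> \<and> (\<Sum>i\<in>UNIV. \<alpha> $ i) = k"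
  using assms
proof (induction k)
  case 0
  then show ?case
    by (intro exI[of _ 0]) (auto simp: less_eq_vec_def)
next
  case (Suc k)
  then obtain \<alpha> where \<alpha>: "\<alpha> \<le> \<beta>" "(\<Sum>i\<in>UNIV. \<alpha> $ i) = k"
    by auto
  have "\<exists>i. \<alpha> $ i < \<beta> $ i"
  proof (rule ccontr)
    assume "\<not> ?thesis"
    then have "(\<Sum>i\<in>UNIV. \<beta> $ i) \<le> (\<Sum>i\<in>UNIV. \<alpha> $ i)"
      by (intro sum_mono) (auto simp: not_less)
    with \<alpha> Suc.prems show False by simp
  qed
  then obtain i where i: "\<alpha> $ i < \<beta> $ i" by blast
  have "\<alpha> + axis i 1 \<le> \<beta>"
    using \<alpha>(1) i by (auto simp: less_eq_vec_def axis_def)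
  moreover have "(\<Sum>j\<in>UNIV. (\<alpha> + axis i 1) $ j) = Suc k"
    using \<alpha>(2) by (simp add: sum.distrib axis_def)
  ultimately show ?case by blast
qed

lemma ideal_power_max_ideal_iff:
  fixes f :: "('a :: comm_ring_1, 'n :: finite) mfps"
  shows "f \<in> ideal_power max_ideal k \<longleftrightarrow> (\<forall>\<alpha>. (\<Sum>i\<in>UNIV. \<alpha> $ i) < k \<longrightarrow> mcoeff f \<alpha> = 0)"
proof
  define Ord :: "nat \<Rightarrow> ('a, 'n) mfps set"
    where "Ord k = {f. \<forall>\<alpha>. (\<Sum>i\<in>UNIV. \<alpha> $ i) < k \<longrightarrow> mcoeff f \<alpha> = 0}" for k
  have mult: "f * g \<in> Ord (k + l)" if "f \<in> Ord k" "g \<in> Ord l" for f g k l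
    unfolding Ord_def
  proof safe
    fix \<alpha> :: "nat^'n"
    assume \<alpha>: "(\<Sum>i\<in>UNIV. \<alpha> $ i) < k + l"
    have "mcoeff f \<beta> * mcoeff g \<gamma> = 0" if "\<beta> + \<gamma> = \<alpha>" for \<beta> \<gamma>
    proof -
      have "(\<Sum>i\<in>UNIV. \<beta> $ i) + (\<Sum>i\<in>UNIV. \<gamma> $ i) < k + l"
        using \<alpha> that by (auto simp: sum.distrib)
      then have "(\<Sum>i\<in>UNIV. \<beta> $ i) < k \<or> (\<Sum>i\<in>UNIV. \<gamma> $ i) < l"
        by linarith
      then show ?thesis
        using \<open>f \<in> Ord k\<close> \<open>g \<in> Ord l\<close> by (auto simp: Ord_def)
    qed
    then show "mcoeff (f * g) \<alpha> = 0"
      unfolding mcoeff_mult by (intro sum.neutral) auto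
  qed
  have sub: "ideal.subspace (Ord k)" for k
    using mult[of _ 0 _ k] by (auto simp: ideal.subspace_def Ord_def)
  have "range mfps_var \<subseteq> Ord 1"
    by (auto simp: Ord_def mfps_var_def mcoeff_monom) (metis axis_nth nat.distinct(1))
  then have max: "max_ideal \<subseteq> Ord 1"
    unfolding max_ideal_def by (intro ideal.span_minimal sub)
  have "(\<Prod>j<k. g j) \<in> Ord k" if "\<forall>j<k. g j \<in> Ord 1" for g k
    using that
  proof (induction k)
    case 0
    then show ?case by (simp add: Ord_def)
  next
    case (Suc k)
    then show ?case using mult[of _ k _ 1] by auto
  qed
  then have "ideal_power max_ideal k \<subseteq> Ord k"
    unfolding ideal_power_def using max by (intro ideal.span_minimal sub) blast
  then show "f \<in> ideal_power max_ideal k \<Longrightarrow> \<forall>\<alpha>. (\<Sum>i\<in>UNIV. \<alpha> $ i) < k \<longrightarrow> mcoeff f \<alpha> = 0"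
    by (auto simp: Ord_def)
next
  assume f: "\<forall>\<alpha>. (\<Sum>i\<in>UNIV. \<alpha> $ i) < k \<longrightarrow> mcoeff f \<alpha> = 0"
  define D where "D = {\<alpha> :: nat^'n. (\<Sum>i\<in>UNIV. \<alpha> $ i) = k}"
  have "\<alpha> $ i \<le> k" if "\<alpha> \<in> D" for \<alpha> i
    using that member_le_sum[of i UNIV "\<lambda>i. \<alpha> $ i"] by (auto simp: D_def)
  then have D: "finite D"
    by (intro finite_subset[OF _ finite_multi_index_le[of "\<chi> i. k"]]) auto
  define c where "c \<beta> = (SOME \<alpha>. \<alpha> \<le> \<beta> \<and> \<alpha> \<in> D)" for \<beta>
  have c: "c \<beta> \<le> \<beta> \<and> c \<beta> \<in> D" if "k \<le> (\<Sum>i\<in>UNIV. \<beta> $ i)" for \<beta>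
  proof -
    have "\<exists>\<alpha>. \<alpha> \<le> \<beta> \<and> \<alpha> \<in> D"
      using ex_multi_index_le[OF that] by (simp add: D_def)
    then show ?thesis
      unfolding c_def by (rule someI_ex)
  qed
  define h where "h \<alpha> = Abs_mfps (\<lambda>\<gamma>. if c (\<gamma> + \<alpha>) = \<alpha> then mcoeff f (\<gamma> + \<alpha>) else 0)" for \<alpha>
  have "f = (\<Sum>\<alpha>\<in>D. h \<alpha> * mfps_monom 1 \<alpha>)"
  proof (rule mfps_eqI)
    fix \<beta> :: "nat^'n"
    have "mcoeff (h \<alpha> * mfps_monom 1 \<alpha>) \<beta> = (if \<alpha> \<le> \<beta> \<and> c \<beta> = \<alpha> then mcoeff f \<beta> else 0)" for \<alpha>
    proof -
      have "\<beta> - \<alpha> + \<alpha> = \<beta>" if "\<alpha> \<le> \<beta>"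
        using that by (auto simp: vec_eq_iff less_eq_vec_def)
      then show ?thesis
        unfolding mult.commute[of "h \<alpha>"] mcoeff_monom_mult by (simp add: h_def)
    qed
    then have *: "mcoeff (\<Sum>\<alpha>\<in>D. h \<alpha> * mfps_monom 1 \<alpha>) \<beta> =
        (\<Sum>\<alpha>\<in>D. if \<alpha> \<le> \<beta> \<and> c \<beta> = \<alpha> then mcoeff f \<beta> else 0)"
      by (simp add: mcoeff_sum)
    show "mcoeff f \<beta> = mcoeff (\<Sum>\<alpha>\<in>D. h \<alpha> * mfps_monom 1 \<alpha>) \<beta>"
    proof (cases "k \<le> (\<Sum>i\<in>UNIV. \<beta> $ i)")
      case True
      have "(\<Sum>\<alpha>\<in>D. if \<alpha> \<le> \<beta> \<and> c \<beta> = \<alpha> then mcoeff f \<beta> else 0) =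
            (\<Sum>\<alpha>\<in>D. if \<alpha> = c \<beta> then mcoeff f \<beta> else 0)"
        using c[OF True] by (intro sum.cong) auto
      then show ?thesis
        using * D c[OF True] by simp
    next
      case False
      then have "mcoeff f \<beta> = 0" using f by simp
      with * show ?thesis by (simp cong: if_cong)
    qed
  qed
  moreover have "(\<Sum>\<alpha>\<in>D. h \<alpha> * mfps_monom 1 \<alpha>) \<in> ideal_power max_ideal k"
    unfolding ideal_power_def
    by (intro ideal.span_sum ideal.span_scale ideal.span_base monom_in_ideal_power) (simp add: D_def)
  ultimately show "f \<in> ideal_power max_ideal k"
    by simp
qed

section \<open>Topologically generated algebras\<close>

definition is_subalgebra :: "('a :: comm_ring_1, 'n :: finite) mfps set \<Rightarrow> bool" where
  "is_subalgebra B \<longleftrightarrow> 1 \<in> B \<and> (\<forall>f\<in>B. \<forall>g\<in>B. f + g \<in> B) \<and> (\<forall>f\<in>B. \<forall>g\<in>B. f * g \<in> B) \<and>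
     (\<forall>c. \<forall>f\<in>B. mfps_monom c 0 * f \<in> B)"

definition power_series_algebra :: "('a :: comm_ring_1, 'n :: finite) mfps set \<Rightarrow> ('a, 'n) mfps set" where
  "power_series_algebra S = closure (is_subalgebra hull S)"

section \<open>Leading exponents\<close>

definition monomial_well_order :: "(nat^'n::finite) rel \<Rightarrow> bool" where
  "monomial_well_order r \<longleftrightarrow> well_order_on UNIV r \<and>
     (\<forall>\<alpha> \<beta> \<gamma>. (\<alpha>, \<beta>) \<in> r \<longrightarrow> (\<alpha> + \<gamma>, \<beta> + \<gamma>) \<in> r)"

definition real_vec :: "nat^'n \<Rightarrow> real^'n::finite" where
  "real_vec \<alpha> = (\<chi> i. real (\<alpha> $ i))"

text \<open>
  For \<open>f \<noteq> 0\<close> and a weight with positive entries the minimum and the maximum below exist, although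
  \<open>Supp f\<close> may be infinite; they are unspecified for \<open>f = 0\<close>.
\<close>

definition weight_order :: "('a :: comm_ring_1, 'n :: finite) mfps \<Rightarrow> real^'n \<Rightarrow> real" where
  "weight_order f a = (LEAST v. v \<in> (\<lambda>\<alpha>. a \<bullet> real_vec \<alpha>) ` Supp f)"

definition initial_form :: "('a :: comm_ring_1, 'n :: finite) mfps \<Rightarrow> real^'n \<Rightarrow> ('a, 'n) mfps" where
  "initial_form f a = Abs_mfps (\<lambda>\<alpha>. if a \<bullet> real_vec \<alpha> = weight_order f a then mcoeff f \<alpha> else 0)"

definition lead_exp ::
  "(nat^'n) rel \<Rightarrow> ('a :: comm_ring_1, 'n :: finite) mfps \<Rightarrow> real^'n \<Rightarrow> nat^'n" where
  "lead_exp r f a = (THE \<alpha>. \<alpha> \<in> Supp (initial_form f a) \<and>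
     (\<forall>\<beta>\<in>Supp (initial_form f a). (\<beta>, \<alpha>) \<in> r))"

definition lead_monom ::
  "(nat^'n) rel \<Rightarrow> ('a :: comm_ring_1, 'n :: finite) mfps \<Rightarrow> real^'n \<Rightarrow> ('a, 'n) mfps" where
  "lead_monom r f a = mfps_monom (mcoeff f (lead_exp r f a)) (lead_exp r f a)"

definition lead_algebra ::
  "(nat^'n) rel \<Rightarrow> ('a :: comm_ring_1, 'n :: finite) mfps set \<Rightarrow> real^'n \<Rightarrow> ('a, 'n) mfps set" where
  "lead_algebra r A a = power_series_algebra {lead_monom r f a | f. f \<in> A - {0}}"

definition lead_exps ::
  "(nat^'n) rel \<Rightarrow> ('a :: comm_ring_1, 'n :: finite) mfps set \<Rightarrow> real^'n \<Rightarrow> (nat^'n) set" where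
  "lead_exps r A a = {lead_exp r f a | f. f \<in> A - {0}}"

section \<open>Cones and finite generation\<close>

definition cone_of :: "nat \<Rightarrow> (nat \<Rightarrow> nat^'n::finite) \<Rightarrow> (real^'n) set" where
  "cone_of s \<alpha> = {\<Sum>i=1..s. t i *\<^sub>R real_vec (\<alpha> i) | t. \<forall>i\<in>{1..s}. 0 \<le> t i}"

definition series_supported_in :: "(real^'n) set \<Rightarrow> ('a :: comm_ring_1, 'n :: finite) mfps set" where
  "series_supported_in C = {f. real_vec ` Supp f \<subseteq> C}"

definition is_submonoid :: "'m :: comm_monoid_add set \<Rightarrow> bool" where
  "is_submonoid M \<longleftrightarrow> 0 \<in> M \<and> (\<forall>x\<in>M. \<forall>y\<in>M. x + y \<in> M)"

definition finitely_generated :: "'m :: comm_monoid_add set \<Rightarrow> bool" where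
  "finitely_generated M \<longleftrightarrow> (\<exists>G. finite G \<and> M = is_submonoid hull G)"

end

theory Submission
  imports Defs
begin

text \<open>
  Write \<open>E\<close> for \<open>lead_exps r A a\<close>. Three facts about \<open>E\<close> are needed. Leading exponents are additive
  on products, because the coefficients lie in a field and \<open>r\<close> is compatible with sums; since \<open>A\<close> is
  closed under multiplication, \<open>E\<close> is a submonoid. It contains the exponents \<open>\<alpha> i\<close>. Finally \<open>E\<close> lies
  in the cone \<open>C\<close>, because the leading monomials of \<open>A\<close> belong to the lead algebra.

  The rest is a statement about submonoids of \<open>nat^'n\<close>
  (\<open>finitely_generated_if_in_cone\<close>), and is Gordan's argument. Rounding down the real coefficients of
  a lattice point of the cone writes it as a natural combination of the \<open>\<alpha> i\<close> plus a remainder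
  \<open>\<gamma>\<close> from a bounded, hence finite, set of lattice points. For a fixed remainder, the tuples of
  natural coefficients that lead into \<open>E\<close> are closed under increasing them, so by Dickson's lemma
  they are the tuples above finitely many of them. These finitely many elements of \<open>E\<close>, one
  batch for each remainder, generate \<open>E\<close> together with the \<open>\<alpha> i\<close>.
\<close>

section \<open>Dickson's lemma\<close>

text \<open>
  Induction on the set of coordinates. A finite \<open>Y\<close> that works for the coordinates \<open>I\<close> also
  works for \<open>insert j I\<close>, except at the points whose coordinate \<open>j\<close> is below the largest one found
  in \<open>Y\<close>; these fall into finitely many slices on which coordinate \<open>j\<close> is constant.
\<close>

lemma dickson:
  fixes X :: "('i \<Rightarrow> nat) set"
  assumes "finite I"
  shows "\<exists>Y\<subseteq>X. finite Y \<and> (\<forall>x\<in>X. \<exists>y\<in>Y. \<forall>i\<in>I. y i \<le> x i)"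
  using assms
proof (induction I arbitrary: X rule: finite_induct)
  case empty
  show ?case
  proof (cases "X = {}")
    case False
    then obtain x where "x \<in> X" by blast
    then show ?thesis by (intro exI[of _ "{x}"]) auto
  qed simp
next
  case (insert j I)
  obtain Y where Y: "Y \<subseteq> X" "finite Y" "\<And>x. x \<in> X \<Longrightarrow> \<exists>y\<in>Y. \<forall>i\<in>I. y i \<le> x i"
    using insert.IH[of X] by blast
  obtain m where m: "\<And>y. y \<in> Y \<Longrightarrow> y j \<le> m"
    using finite_nat_set_iff_bounded_le[of "(\<lambda>y. y j) ` Y"] Y(2) by auto
  have "\<forall>k. \<exists>Z\<subseteq>{x\<in>X. x j = k}. finite Z \<and> (\<forall>x\<in>{x\<in>X. x j = k}. \<exists>y\<in>Z. \<forall>i\<in>I. y i \<le> x i)"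
    using insert.IH by blast
  from choice[OF this] obtain Z where "\<forall>k. Z k \<subseteq> {x\<in>X. x j = k} \<and> finite (Z k) \<and>
      (\<forall>x\<in>{x\<in>X. x j = k}. \<exists>y\<in>Z k. \<forall>i\<in>I. y i \<le> x i)" ..
  then have Z: "\<And>k. Z k \<subseteq> {x\<in>X. x j = k}" "\<And>k. finite (Z k)"
    "\<And>k x. x \<in> X \<Longrightarrow> x j = k \<Longrightarrow> \<exists>y\<in>Z k. \<forall>i\<in>I. y i \<le> x i"
    by simp_all
  have "\<exists>y\<in>Y \<union> (\<Union>k<m. Z k). \<forall>i\<in>insert j I. y i \<le> x i" if x: "x \<in> X" for x
  proof (cases "x j < m")
    case True
    obtain y where y: "y \<in> Z (x j)" "\<forall>i\<in>I. y i \<le> x i"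
      using Z(3)[OF x refl] by blast
    then have "y j = x j" using Z(1) by blast
    with y True show ?thesis by (intro bexI[of _ y]) auto
  next
    case False
    obtain y where "y \<in> Y" "\<forall>i\<in>I. y i \<le> x i"
      using Y(3)[OF x] by blast
    with m[of y] False show ?thesis by (intro bexI[of _ y]) auto
  qed
  moreover have "Y \<union> (\<Union>k<m. Z k) \<subseteq> X" "finite (Y \<union> (\<Union>k<m. Z k))"
    using Y(1,2) Z(1,2) by (blast, simp)
  ultimately show ?case by (intro exI[of _ "Y \<union> (\<Union>k<m. Z k)"]) blast
qed

section \<open>Monoids of lattice points in a finitely generated cone\<close>

lemma is_submonoid_hull: "is_submonoid (is_submonoid hull G)"
  by (rule hull_in) (auto simp: is_submonoid_def)

lemma submonoid_sum:
  assumes "is_submonoid M" "\<And>i. i \<in> I \<Longrightarrow> g i \<in> M"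
  shows "sum g I \<in> M"
  using assms(2)
  by (induction I rule: infinite_finite_induct) (use assms(1) in \<open>auto simp: is_submonoid_def\<close>)

lemma submonoid_scale:
  fixes M :: "(nat^'n::finite) set"
  assumes "is_submonoid M" "x \<in> M"
  shows "n *s x \<in> M"
proof (induction n)
  case 0
  have "0 *s x = 0" by (simp add: vec_eq_iff)
  then show ?case using assms by (simp add: is_submonoid_def)
next
  case (Suc n)
  have "Suc n *s x = x + n *s x" by (simp add: vec_eq_iff)
  then show ?case using assms Suc by (simp add: is_submonoid_def)
qed

text \<open>
  Rounding down the coefficients \<open>t i\<close> of a cone representation of \<open>\<beta>\<close> leaves the remainder
  \<open>\<Sum>i. frac (t i) * \<alpha> i\<close>, which is integral, because \<open>\<beta>\<close> and the \<open>\<alpha> i\<close> are, and bounded by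
  \<open>\<Sum>i. \<alpha> i\<close>. The bound does not depend on \<open>\<beta>\<close>.
\<close>

lemma cone_lattice_point_decomposition:
  fixes \<beta> :: "nat^'n::finite"
  assumes "real_vec \<beta> \<in> cone_of s \<alpha>"
  obtains \<gamma> n where "\<beta> = \<gamma> + (\<Sum>i=1..s. n i *s \<alpha> i)" "\<And>j. \<gamma> $ j \<le> (\<Sum>i=1..s. \<alpha> i) $ j"
proof -
  obtain t where t: "real_vec \<beta> = (\<Sum>i=1..s. t i *\<^sub>R real_vec (\<alpha> i))" "\<And>i. i \<in> {1..s} \<Longrightarrow> 0 \<le> t i"
    using assms unfolding cone_of_def by blast
  define n where "n i = nat \<lfloor>t i\<rfloor>" for i
  have n: "real (n i) \<le> t i" "t i \<le> real (n i) + 1" if "i \<in> {1..s}" for i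
    using t(2)[OF that] by (auto simp: n_def)
  have \<beta>: "real (\<beta> $ j) = (\<Sum>i=1..s. t i * real (\<alpha> i $ j))" for j
    using arg_cong[OF t(1), of "\<lambda>v. v $ j"] by (simp add: real_vec_def)
  define \<gamma> where "\<gamma> = \<beta> - (\<Sum>i=1..s. n i *s \<alpha> i)"
  have "(\<Sum>i=1..s. n i *s \<alpha> i) $ j \<le> \<beta> $ j" for j
  proof -
    have "real ((\<Sum>i=1..s. n i *s \<alpha> i) $ j) \<le> real (\<beta> $ j)"
      using n(1) by (auto simp: \<beta> intro!: sum_mono mult_right_mono)
    then show ?thesis unfolding of_nat_le_iff .
  qed
  then have decomp: "\<beta> = \<gamma> + (\<Sum>i=1..s. n i *s \<alpha> i)"
    by (simp add: \<gamma>_def vec_eq_iff)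
  have "\<gamma> $ j \<le> (\<Sum>i=1..s. \<alpha> i) $ j" for j
  proof -
    have "real (\<beta> $ j) \<le> (\<Sum>i=1..s. (real (n i) + 1) * real (\<alpha> i $ j))"
      unfolding \<beta> by (intro sum_mono mult_right_mono n) auto
    also have "\<dots> = real ((\<Sum>i=1..s. n i *s \<alpha> i) $ j + (\<Sum>i=1..s. \<alpha> i) $ j)"
      by (simp add: distrib_right sum.distrib)
    finally show ?thesis
      unfolding of_nat_le_iff by (subst (asm) decomp) simp
  qed
  with decomp show thesis by (rule that)
qed

text \<open>
  Besides the \<open>\<alpha> i\<close>, the generators are points \<open>\<gamma> + (\<Sum>i. y i * \<alpha> i)\<close> of \<open>M\<close>, where \<open>\<gamma>\<close> runs
  through the finitely many possible remainders and \<open>y\<close> through finitely many tuples, chosen by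
  Dickson's lemma, such that every tuple that leads from \<open>\<gamma>\<close> into \<open>M\<close> lies above one of them. A
  point of \<open>M\<close> with remainder \<open>\<gamma>\<close> then exceeds one of these generators by a natural combination
  of the \<open>\<alpha> i\<close>.
\<close>

theorem finitely_generated_if_in_cone:
  fixes M :: "(nat^'n::finite) set"
  assumes M: "is_submonoid M"
    and gens: "\<And>i. i \<in> {1..s} \<Longrightarrow> \<alpha> i \<in> M"
    and cone: "real_vec ` M \<subseteq> cone_of s \<alpha>"
  shows "finitely_generated M"
proof -
  define comb where "comb n = (\<Sum>i=1..s. n i *s \<alpha> i)" for n
  define \<Gamma> where "\<Gamma> = {\<gamma>. \<forall>j. \<gamma> $ j \<le> (\<Sum>i=1..s. \<alpha> i) $ j}"
  have "\<forall>\<gamma>. \<exists>Y\<subseteq>{n. \<gamma> + comb n \<in> M}. finite Y \<and>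
      (\<forall>n\<in>{n. \<gamma> + comb n \<in> M}. \<exists>y\<in>Y. \<forall>i\<in>{1..s}. y i \<le> n i)"
    by (intro allI dickson) simp
  from choice[OF this] obtain Y where "\<forall>\<gamma>. Y \<gamma> \<subseteq> {n. \<gamma> + comb n \<in> M} \<and> finite (Y \<gamma>) \<and>
      (\<forall>n\<in>{n. \<gamma> + comb n \<in> M}. \<exists>y\<in>Y \<gamma>. \<forall>i\<in>{1..s}. y i \<le> n i)" ..
  then have Y: "\<And>\<gamma>. Y \<gamma> \<subseteq> {n. \<gamma> + comb n \<in> M}" "\<And>\<gamma>. finite (Y \<gamma>)"
    "\<And>\<gamma> n. \<gamma> + comb n \<in> M \<Longrightarrow> \<exists>y\<in>Y \<gamma>. \<forall>i\<in>{1..s}. y i \<le> n i"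
    by simp_all
  define G where "G = \<alpha> ` {1..s} \<union> (\<Union>\<gamma>\<in>\<Gamma>. (\<lambda>y. \<gamma> + comb y) ` Y \<gamma>)"
  have "finite G"
    unfolding G_def \<Gamma>_def by (intro finite_UnI finite_UN_I finite_imageI finite_multi_index_le Y(2)) simp
  moreover have "M = is_submonoid hull G"
  proof
    have "G \<subseteq> M" using gens Y(1) by (auto simp: G_def)
    then show "is_submonoid hull G \<subseteq> M" using M by (rule hull_minimal)
  next
    show "M \<subseteq> is_submonoid hull G"
    proof
      fix \<beta> assume \<beta>: "\<beta> \<in> M"
      with cone have "real_vec \<beta> \<in> cone_of s \<alpha>" by blast
      then obtain \<gamma> n where \<gamma>: "\<beta> = \<gamma> + comb n" "\<gamma> \<in> \<Gamma>"
        unfolding comb_def \<Gamma>_def by (rule cone_lattice_point_decomposition) auto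
      with \<beta> obtain y where y: "y \<in> Y \<gamma>" "\<And>i. i \<in> {1..s} \<Longrightarrow> y i \<le> n i"
        using Y(3) by blast
      have "comb n = comb y + comb (\<lambda>i. n i - y i)"
        unfolding comb_def sum.distrib[symmetric] vector_sadd_rdistrib[symmetric]
        using y(2) by (intro sum.cong) simp_all
      then have "\<beta> = (\<gamma> + comb y) + comb (\<lambda>i. n i - y i)"
        by (simp add: \<gamma> add.assoc)
      moreover have "\<gamma> + comb y \<in> is_submonoid hull G"
        by (rule hull_inc) (use \<gamma>(2) y(1) in \<open>auto simp: G_def\<close>)
      moreover have "comb (\<lambda>i. n i - y i) \<in> is_submonoid hull G"
        unfolding comb_def
        by (intro submonoid_sum submonoid_scale is_submonoid_hull hull_inc) (auto simp: G_def)
      ultimately show "\<beta> \<in> is_submonoid hull G"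
        using is_submonoid_hull[of G] by (simp add: is_submonoid_def)
    qed
  qed
  ultimately show ?thesis unfolding finitely_generated_def by blast
qed

section \<open>Leading exponents of products\<close>

text \<open>
  A description of the leading exponent in terms of the support alone, without the intermediate
  \<open>weight_order\<close> and \<open>initial_form\<close>; in this form it can be checked for a product by comparing
  the exponents of the factors.
\<close>

definition is_lead_exp ::
  "(nat^'n) rel \<Rightarrow> real^'n \<Rightarrow> ('a :: comm_ring_1, 'n :: finite) mfps \<Rightarrow> nat^'n \<Rightarrow> bool" where
  "is_lead_exp r a f e \<longleftrightarrow> e \<in> Supp f \<and> (\<forall>\<beta>\<in>Supp f. a \<bullet> real_vec e \<le> a \<bullet> real_vec \<beta> \<and>
     (a \<bullet> real_vec \<beta> = a \<bullet> real_vec e \<longrightarrow> (\<beta>, e) \<in> r))"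

lemma real_vec_add: "real_vec (\<alpha> + \<beta>) = real_vec \<alpha> + real_vec \<beta>"
  by (simp add: real_vec_def vec_eq_iff)

lemma monomial_well_orderD:
  assumes "monomial_well_order r"
  shows "(\<alpha>, \<alpha>) \<in> r" "(\<alpha>, \<beta>) \<in> r \<Longrightarrow> (\<beta>, \<alpha>) \<in> r \<Longrightarrow> \<alpha> = \<beta>"
    "(\<alpha>, \<beta>) \<in> r \<Longrightarrow> (\<beta>, \<gamma>) \<in> r \<Longrightarrow> (\<alpha>, \<gamma>) \<in> r" "(\<alpha>, \<beta>) \<in> r \<or> (\<beta>, \<alpha>) \<in> r"
    "(\<alpha>, \<beta>) \<in> r \<Longrightarrow> (\<alpha> + \<gamma>, \<beta> + \<gamma>) \<in> r"
proof -
  have "refl r" "trans r" "antisym r" "total r"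
    using assms by (auto simp: monomial_well_order_def well_order_on_def linear_order_on_def
        partial_order_on_def preorder_on_def)
  then show "(\<alpha>, \<alpha>) \<in> r" "(\<alpha>, \<beta>) \<in> r \<or> (\<beta>, \<alpha>) \<in> r"
    "(\<alpha>, \<beta>) \<in> r \<Longrightarrow> (\<beta>, \<alpha>) \<in> r \<Longrightarrow> \<alpha> = \<beta>"
    "(\<alpha>, \<beta>) \<in> r \<Longrightarrow> (\<beta>, \<gamma>) \<in> r \<Longrightarrow> (\<alpha>, \<gamma>) \<in> r"
    by (metis refl_on_def total_on_def antisymD transD UNIV_I)+
  show "(\<alpha>, \<beta>) \<in> r \<Longrightarrow> (\<alpha> + \<gamma>, \<beta> + \<gamma>) \<in> r"
    using assms by (auto simp: monomial_well_order_def)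
qed

lemma lead_exp_eqI:
  assumes r: "monomial_well_order r" and e: "is_lead_exp r a f e"
  shows "lead_exp r f a = e"
proof -
  have w: "weight_order f a = a \<bullet> real_vec e"
    unfolding weight_order_def using e by (intro Least_equality) (auto simp: is_lead_exp_def)
  have S: "\<beta> \<in> Supp (initial_form f a) \<longleftrightarrow> \<beta> \<in> Supp f \<and> a \<bullet> real_vec \<beta> = a \<bullet> real_vec e" for \<beta>
    by (auto simp: Supp_def initial_form_def w)
  show ?thesis
    unfolding lead_exp_def
    by (rule the_equality)
       (use e monomial_well_orderD(2)[OF r] in \<open>auto simp: S is_lead_exp_def\<close>)
qed

text \<open>
  All entries of \<open>a\<close> are positive, so a bound on the weight bounds every coordinate.
\<close>

lemma finite_weight_le:
  fixes a :: "real^'n::finite"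
  assumes "\<forall>i. 0 < a $ i"
  shows "finite {\<alpha>. a \<bullet> real_vec \<alpha> \<le> v}"
proof (rule finite_subset[OF _ finite_multi_index_le])
  show "{\<alpha>. a \<bullet> real_vec \<alpha> \<le> v} \<subseteq> {\<alpha>. \<forall>i. \<alpha> $ i \<le> (\<chi> i. nat \<lceil>v / a $ i\<rceil>) $ i}"
  proof safe
    fix \<alpha> :: "nat^'n" and i assume v: "a \<bullet> real_vec \<alpha> \<le> v"
    have "a $ i * real (\<alpha> $ i) \<le> (\<Sum>i\<in>UNIV. a $ i * real (\<alpha> $ i))"
      by (rule member_le_sum) (use assms in \<open>auto simp: less_imp_le\<close>)
    also have "\<dots> \<le> v" using v by (simp add: inner_vec_def real_vec_def)
    finally have "real (\<alpha> $ i) \<le> v / a $ i"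
      using assms by (simp add: field_simps)
    then show "\<alpha> $ i \<le> (\<chi> i. nat \<lceil>v / a $ i\<rceil>) $ i" by simp linarith
  qed
qed

lemma finite_linear_order_max:
  assumes r: "monomial_well_order r" and "finite S" "S \<noteq> {}"
  shows "\<exists>e\<in>S. \<forall>\<beta>\<in>S. (\<beta>, e) \<in> r"
  using assms(2,3)
proof (induction S rule: finite_ne_induct)
  case (singleton x)
  then show ?case using monomial_well_orderD(1)[OF r] by simp
next
  case (insert x S)
  then obtain e where e: "e \<in> S" "\<forall>\<beta>\<in>S. (\<beta>, e) \<in> r" by blast
  show ?case
  proof (cases "(x, e) \<in> r")
    case True
    with e show ?thesis by blast
  next
    case False
    then have "(e, x) \<in> r" using monomial_well_orderD(4)[OF r] by blast
    with e show ?thesis using monomial_well_orderD(1,3)[OF r] by blast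
  qed
qed

lemma is_lead_exp_lead_exp:
  assumes r: "monomial_well_order r" and a: "\<forall>i. 0 < a $ i" and "f \<noteq> 0"
  shows "is_lead_exp r a f (lead_exp r f a)"
proof -
  define w where "w \<alpha> = a \<bullet> real_vec \<alpha>" for \<alpha>
  obtain \<delta> where \<delta>: "\<delta> \<in> Supp f"
    using \<open>f \<noteq> 0\<close> by (auto simp: Supp_def mfps_eq_iff)
  have fin: "finite {\<alpha>\<in>Supp f. w \<alpha> \<le> w \<delta>}"
    using finite_subset[OF _ finite_weight_le[OF a, of "w \<delta>"]] by (auto simp: w_def)
  define \<mu> where "\<mu> = arg_min_on w {\<alpha>\<in>Supp f. w \<alpha> \<le> w \<delta>}"
  have \<mu>: "\<mu> \<in> Supp f" "w \<mu> \<le> w \<delta>"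
    using arg_min_if_finite(1)[OF fin, of w] \<delta> by (auto simp: \<mu>_def)
  have min: "w \<mu> \<le> w \<beta>" if "\<beta> \<in> Supp f" for \<beta>
  proof (cases "w \<beta> \<le> w \<delta>")
    case True
    then show ?thesis
      unfolding \<mu>_def using that \<delta> by (intro arg_min_least[OF fin]) auto
  qed (use \<mu>(2) in simp)
  have "finite {\<beta>\<in>Supp f. w \<beta> = w \<mu>}"
    by (rule finite_subset[OF _ fin]) (use \<mu>(2) in auto)
  then obtain e where e: "e \<in> {\<beta>\<in>Supp f. w \<beta> = w \<mu>}" "\<forall>\<beta>\<in>{\<beta>\<in>Supp f. w \<beta> = w \<mu>}. (\<beta>, e) \<in> r"
    using finite_linear_order_max[OF r, of "{\<beta>\<in>Supp f. w \<beta> = w \<mu>}"] \<mu>(1) by blast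
  then have "is_lead_exp r a f e"
    using min by (auto simp: is_lead_exp_def w_def)
  then show ?thesis using lead_exp_eqI[OF r] by metis
qed

text \<open>
  Among the pairs \<open>(\<beta>, \<gamma>)\<close> of exponents of the factors, the sum \<open>\<beta> + \<gamma>\<close> has least weight only
  if both summands do, and is then largest for \<open>r\<close> only at the pair of leading exponents. So the
  coefficient of the product at \<open>d + e\<close> is a single product of nonzero field elements.
\<close>

lemma is_lead_exp_mult:
  fixes f g :: "('k::field, 'n::finite) mfps"
  assumes r: "monomial_well_order r" and d: "is_lead_exp r a f d" and e: "is_lead_exp r a g e"
  shows "is_lead_exp r a (f * g) (d + e)"
proof -
  note ord = monomial_well_orderD[OF r]
  define w where "w \<alpha> = a \<bullet> real_vec \<alpha>" for \<alpha>
  have w_add: "w (\<beta> + \<gamma>) = w \<beta> + w \<gamma>" for \<beta> \<gamma>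
    by (simp add: w_def real_vec_add inner_add_right)
  have d': "d \<in> Supp f" "\<And>\<beta>. \<beta> \<in> Supp f \<Longrightarrow> w d \<le> w \<beta>"
      "\<And>\<beta>. \<beta> \<in> Supp f \<Longrightarrow> w \<beta> = w d \<Longrightarrow> (\<beta>, d) \<in> r"
    and e': "e \<in> Supp g" "\<And>\<beta>. \<beta> \<in> Supp g \<Longrightarrow> w e \<le> w \<beta>"
      "\<And>\<beta>. \<beta> \<in> Supp g \<Longrightarrow> w \<beta> = w e \<Longrightarrow> (\<beta>, e) \<in> r"
    using d e by (auto simp: is_lead_exp_def w_def)
  have le: "w (d + e) \<le> w (\<beta> + \<gamma>)" if "\<beta> \<in> Supp f" "\<gamma> \<in> Supp g" for \<beta> \<gamma>
    using d'(2)[OF that(1)] e'(2)[OF that(2)] by (simp add: w_add)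
  have step: "(\<beta> + \<gamma>, d + \<gamma>) \<in> r \<and> (d + \<gamma>, d + e) \<in> r"
    if "\<beta> \<in> Supp f" "\<gamma> \<in> Supp g" "w (\<beta> + \<gamma>) = w (d + e)" for \<beta> \<gamma>
  proof -
    have "w \<beta> = w d" "w \<gamma> = w e"
      using d'(2)[OF that(1)] e'(2)[OF that(2)] that(3) by (auto simp: w_add)
    then have "(\<beta>, d) \<in> r" "(\<gamma>, e) \<in> r" using d'(3) e'(3) that by auto
    then show ?thesis
      using ord(5)[of \<beta> d \<gamma>] ord(5)[of \<gamma> e d] by (simp add: add.commute)
  qed
  have "mcoeff (f * g) (d + e) = (\<Sum>(\<beta>, \<gamma>) \<in> {(d, e)}. mcoeff f \<beta> * mcoeff g \<gamma>)"
    unfolding mcoeff_mult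
  proof (rule sum.mono_neutral_right[OF finite_multi_index_split], safe)
    fix \<beta> \<gamma>
    assume eq: "\<beta> + \<gamma> = d + e" and ne: "mcoeff f \<beta> * mcoeff g \<gamma> \<noteq> 0"
    then have "(d + e, d + \<gamma>) \<in> r \<and> (d + \<gamma>, d + e) \<in> r"
      using step[of \<beta> \<gamma>] by (auto simp: Supp_def)
    then have "d + e = d + \<gamma>" using ord(2) by blast
    then have "\<gamma> = e" by (simp add: vec_eq_iff)
    with eq show "\<beta> = d" "\<gamma> = e" by (simp_all add: vec_eq_iff)
  qed
  then have in_supp: "d + e \<in> Supp (f * g)"
    using d'(1) e'(1) by (simp add: Supp_def)
  have "w (d + e) \<le> w \<epsilon> \<and> (w \<epsilon> = w (d + e) \<longrightarrow> (\<epsilon>, d + e) \<in> r)"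
    if "\<epsilon> \<in> Supp (f * g)" for \<epsilon>
  proof -
    have "\<exists>p\<in>{(\<beta>, \<gamma>). \<beta> + \<gamma> = \<epsilon>}. (case p of (\<beta>, \<gamma>) \<Rightarrow> mcoeff f \<beta> * mcoeff g \<gamma>) \<noteq> 0"
      using that unfolding Supp_def mem_Collect_eq mcoeff_mult by (meson sum.neutral)
    then obtain \<beta> \<gamma> where "\<epsilon> = \<beta> + \<gamma>" "\<beta> \<in> Supp f" "\<gamma> \<in> Supp g"
      by (auto simp: Supp_def)
    then show ?thesis using le step ord(3) by blast
  qed
  with in_supp show ?thesis by (simp add: is_lead_exp_def w_def)
qed

section \<open>Algebra structure on the topological closure\<close>

text \<open>
  The cosets of the powers of \<open>max_ideal\<close> are themselves open, since these powers are closed under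
  addition; hence they suffice to test membership in a closure.
\<close>

lemma closure_mfps_iff:
  fixes f :: "('a :: comm_ring_1, 'n :: finite) mfps"
  shows "f \<in> closure S \<longleftrightarrow> (\<forall>k. \<exists>g\<in>S. g - f \<in> ideal_power max_ideal k)"
proof
  assume f: "f \<in> closure S"
  show "\<forall>k. \<exists>g\<in>S. g - f \<in> ideal_power max_ideal k"
  proof
    fix k
    let ?U = "{g. g - f \<in> ideal_power max_ideal k}"
    have "open ?U"
      unfolding open_mfps_def
    proof safe
      fix g assume g: "g - f \<in> ideal_power max_ideal k"
      have "h - f \<in> ideal_power max_ideal k" if "h - g \<in> ideal_power max_ideal k" for h
      proof -
        have "(h - g) + (g - f) \<in> ideal_power max_ideal k"
          using that g unfolding ideal_power_def by (rule ideal.span_add)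
        then show ?thesis by simp
      qed
      then show "\<exists>l. \<forall>h. h - g \<in> ideal_power max_ideal l \<longrightarrow> h \<in> ?U" by blast
    qed
    moreover have "f \<in> ?U" unfolding ideal_power_def by (simp add: ideal.span_zero)
    ultimately have "S \<inter> ?U \<noteq> {}"
      using f open_Int_closure_eq_empty[of ?U S] by blast
    then show "\<exists>g\<in>S. g - f \<in> ideal_power max_ideal k" by blast
  qed
next
  assume R: "\<forall>k. \<exists>g\<in>S. g - f \<in> ideal_power max_ideal k"
  show "f \<in> closure S"
  proof (rule ccontr)
    assume "f \<notin> closure S"
    moreover have "open (- closure S)" by (intro open_Compl closed_closure)
    ultimately obtain k where "\<forall>g. g - f \<in> ideal_power max_ideal k \<longrightarrow> g \<in> - closure S"
      unfolding open_mfps_def by blast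
    with R closure_subset[of S] show False by blast
  qed
qed

lemma is_subalgebra_hull: "is_subalgebra (is_subalgebra hull S)"
  by (rule hull_in) (auto simp: is_subalgebra_def)

lemma power_series_algebra_base: "S \<subseteq> power_series_algebra S"
  unfolding power_series_algebra_def by (rule order_trans[OF hull_subset closure_subset])

lemma one_in_power_series_algebra: "1 \<in> power_series_algebra S"
  unfolding power_series_algebra_def
  by (rule subsetD[OF closure_subset]) (use is_subalgebra_hull[of S] in \<open>simp add: is_subalgebra_def\<close>)

lemma power_series_algebra_mult:
  assumes "f \<in> power_series_algebra S" "g \<in> power_series_algebra S"
  shows "f * g \<in> power_series_algebra S"
  unfolding power_series_algebra_def closure_mfps_iff
proof
  fix k
  obtain f' g' where f': "f' \<in> is_subalgebra hull S" "f' - f \<in> ideal_power max_ideal k"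
    and g': "g' \<in> is_subalgebra hull S" "g' - g \<in> ideal_power max_ideal k"
    using assms unfolding power_series_algebra_def closure_mfps_iff by blast
  have "f * (g' - g) + g' * (f' - f) \<in> ideal_power max_ideal k"
    using f'(2) g'(2) unfolding ideal_power_def by (intro ideal.span_add ideal.span_scale)
  then have "f' * g' - f * g \<in> ideal_power max_ideal k"
    by (simp add: algebra_simps)
  moreover have "f' * g' \<in> is_subalgebra hull S"
    using f' g' is_subalgebra_hull[of S] by (simp add: is_subalgebra_def)
  ultimately show "\<exists>h\<in>is_subalgebra hull S. h - f * g \<in> ideal_power max_ideal k"
    by blast
qed

section \<open>Finite generation of the exponents\<close>

lemma lead_exps_memI: "f \<in> A \<Longrightarrow> f \<noteq> 0 \<Longrightarrow> lead_exp r f a \<in> lead_exps r A a"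
  by (auto simp: lead_exps_def)

lemma is_submonoid_lead_exps:
  fixes S :: "('k::field, 'n::finite) mfps set"
  assumes r: "monomial_well_order r" and a: "\<forall>i. 0 < a $ i"
  shows "is_submonoid (lead_exps r (power_series_algebra S) a)"
  unfolding is_submonoid_def
proof (intro conjI ballI)
  have "is_lead_exp r a (1 :: ('k, 'n) mfps) 0"
    using monomial_well_orderD(1)[OF r] by (auto simp: is_lead_exp_def Supp_def mcoeff_one)
  then have "lead_exp r (1 :: ('k, 'n) mfps) a = 0" by (rule lead_exp_eqI[OF r])
  then show "0 \<in> lead_exps r (power_series_algebra S) a"
    by (metis lead_exps_memI one_in_power_series_algebra one_neq_zero)
next
  fix d e
  assume "d \<in> lead_exps r (power_series_algebra S) a" "e \<in> lead_exps r (power_series_algebra S) a"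
  then obtain f g where fg: "f \<in> power_series_algebra S" "g \<in> power_series_algebra S"
    "f \<noteq> 0" "g \<noteq> 0" "d = lead_exp r f a" "e = lead_exp r g a"
    by (auto simp: lead_exps_def)
  have lead: "is_lead_exp r a (f * g) (d + e)"
    unfolding fg(5,6) by (intro is_lead_exp_mult is_lead_exp_lead_exp r a fg(3,4))
  then have "f * g \<noteq> 0" by (auto simp: is_lead_exp_def Supp_def)
  moreover have "f * g \<in> power_series_algebra S"
    using fg(1,2) by (rule power_series_algebra_mult)
  ultimately show "d + e \<in> lead_exps r (power_series_algebra S) a"
    using lead_exp_eqI[OF r lead] lead_exps_memI[of "f * g"] by metis
qed

lemma lead_exps_in_support:
  fixes A :: "('k::field, 'n::finite) mfps set"
  assumes r: "monomial_well_order r" and a: "\<forall>i. 0 < a $ i"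
    and C: "lead_algebra r A a \<subseteq> series_supported_in C"
  shows "real_vec ` lead_exps r A a \<subseteq> C"
proof safe
  fix e assume "e \<in> lead_exps r A a"
  then obtain f where f: "f \<in> A - {0}" "e = lead_exp r f a" by (auto simp: lead_exps_def)
  then have "e \<in> Supp (lead_monom r f a)"
    using is_lead_exp_lead_exp[OF r a, of f]
    by (simp add: is_lead_exp_def Supp_def lead_monom_def mcoeff_monom)
  moreover have "lead_monom r f a \<in> lead_algebra r A a"
    unfolding lead_algebra_def by (rule subsetD[OF power_series_algebra_base]) (use f(1) in blast)
  ultimately show "real_vec e \<in> C" using C by (auto simp: series_supported_in_def)
qed

theorem proposition19:
  fixes r :: "(nat^'n::finite) rel"
    and f :: "nat \<Rightarrow> ('k::field, 'n) mfps"
    and s :: nat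
    and a :: "real^'n"
    and A :: "('k, 'n) mfps set"
    and \<alpha> :: "nat \<Rightarrow> nat^'n"
    and C :: "(real^'n) set"
  assumes "monomial_well_order r"
    and "\<forall>i\<in>{1..s}. f i \<noteq> 0"
    and "A = power_series_algebra (f ` {1..s})"
    and "\<forall>i. 0 < a $ i"
    and "\<forall>i\<in>{1..s}. \<alpha> i = lead_exp r (f i) a"
    and "C = cone_of s \<alpha>"
    and "lead_algebra r A a \<subseteq> series_supported_in C"
  shows "finitely_generated (lead_exps r A a)"
proof (rule finitely_generated_if_in_cone)
  show "is_submonoid (lead_exps r A a)"
    unfolding assms(3) using assms(1,4) by (rule is_submonoid_lead_exps)
  show "\<alpha> i \<in> lead_exps r A a" if "i \<in> {1..s}" for i
  proof -
    have "f i \<in> A"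
      unfolding assms(3) by (rule subsetD[OF power_series_algebra_base]) (use that in blast)
    with that show ?thesis using assms(2,5) by (simp add: lead_exps_memI)
  qed
  show "real_vec ` lead_exps r A a \<subseteq> cone_of s \<alpha>"
    using lead_exps_in_support[OF assms(1,4,7)] by (simp only: assms(6))
qed

end
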